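(* Let $(K\to M,C,\mathcal U,g,\kappa,h,D,\mathcal Q)$ be a CV-structure with the unfolding condition, and let $I:TM\to K$, $I(X)=-C_X(\zeta)$, be the isomorphism defined by a primitive section $\zeta$. Then $$\mathcal Q=\bigl(D_{I^{-1}}(\mathcal U)(\zeta)\bigr)^{skew},$$ where $D_{I^{-1}}(\mathcal U)(\zeta)$ is the smooth endomorphism of $K$ given by $$D_{I^{-1}}(\mathcal U)(\zeta)(s):=D_{I^{-1}(s)}(\mathcal U)(\zeta),\qquad s\in\mathcal O(K),$$ and the superscript "skew" means its skew-symmetric part with respect to $g$.
   Context: $M$ is a complex manifold, $TM$ its holomorphic tangent bundle, $\mathcal T_M$ the sheaf of holomorphic vector fields, $\mathcal O(K)$ the sheaf of holomorphic sections of $K$. **CV-structure.** A CV-structure is a tuple $(K\to M,C,\mathcal U,g,\kappa,h,D,\mathcal Q)$ where: - $K\to M$ is a holomorphic vector bundle, $C\in\Omega^1_M\otimes\mathcal O(\mathrm{End}K)$ and $\mathcal U\in\mathcal O(\mathrm{End}K)$ are holomorphic, $g$ is a holomorphic symmetric non-degenerate bilinear form on $K$, with $C_XC_Y=C_YC_X$, $[C_X,\mathcal U]=0$, $g(C_Xa,b)=g(a,C_Xb)$, $g(\mathcal U a,b)=g(a,\mathcal U b)$; - $\kappa:K\to K$ is a smooth fibrewise $\mathbb C$-antilinear bundle map, $\kappa^2=\mathrm{id}$, $g(\kappa a,\kappa b)=\overline{g(a,b)}$; - $h:=g(\cdot,\kappa\cdot)$ is a non-degenerate (possibly indefinite) hermitian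 form, linear in the first and conjugate linear in the second argument, and its Chern connection $D$ satisfies, for $X,Y\in\mathcal T_M$: $D(\kappa)=0$ (i.e. $D_X(\kappa a)=\kappa D_{\bar X}a$), $D_X(C_Y)-D_Y(C_X)-C_{[X,Y]}=0$, and $R^D(X,\bar Y)+[C_X,\kappa C_Y\kappa]=0$, where $R^D$ is the curvature of $D$; - $\mathcal Q$ is a smooth endomorphism of $K$ with $g(\mathcal Qa,b)=-g(a,\mathcal Qb)$, $h(\mathcal Qa,b)=h(a,\mathcal Qb)$, and for $X\in\mathcal T_M$: $D_X(\mathcal U)-[C_X,\mathcal Q]+C_X=0$, $D_X(\mathcal Q)+[C_X,\kappa\,\mathcal U\kappa]=0$. **Unfolding condition.** There is a section $\zeta\in\mathcal O(K)$ (called a primitive section) such that $TM\to K$, $X\mapsto -C_X(\zeta)$, is an isomorphism. Here $D_X(\mathcal U)$ is the covariant derivative of the endomorphism $\mathcal U$. *)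

theory Defs
  imports "HOL-Analysis.Analysis" "HOL-Library.Function_Algebras"
begin

definition holo_on :: "(complex ^ 'n) set \<Rightarrow> (complex ^ 'n \<Rightarrow> complex) \<Rightarrow> bool" where
  "holo_on S f \<longleftrightarrow>
     (\<forall>x\<in>S. \<exists>L. (f has_derivative L) (at x) \<and> (\<forall>c v. L (c *s v) = c * L v))"

text \<open>On an open subset of a finite-dimensional space this is the usual class of k times
  continuously differentiable functions, expressed through iterated directional derivatives.\<close>

primrec Ck_on :: "nat \<Rightarrow> 'a::real_normed_vector set \<Rightarrow> ('a \<Rightarrow> 'b::real_normed_vector) \<Rightarrow> bool" where
  "Ck_on 0 S f \<longleftrightarrow> continuous_on S f"
| "Ck_on (Suc k) S f \<longleftrightarrow>
     (\<forall>x\<in>S. f differentiable (at x)) \<and> (\<forall>v. Ck_on k S (\<lambda>x. frechet_derivative f (at x) v))"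

definition smooth_on :: "'a::real_normed_vector set \<Rightarrow> ('a \<Rightarrow> 'b::real_normed_vector) \<Rightarrow> bool" where
  "smooth_on S f \<longleftrightarrow> (\<forall>k. Ck_on k S f)"

text \<open>The pair \<open>(v, w)\<close> stands for the complexified tangent vector
  \<open>\<Sum>i. v_i * \<partial>/\<partial>z_i + \<Sum>i. cnj w_i * \<partial>/\<partial>(cnj z_i)\<close>.\<close>

definition wirtinger :: "(complex ^ 'n \<Rightarrow> complex) \<Rightarrow> complex ^ 'n \<Rightarrow>
    (complex ^ 'n) \<times> (complex ^ 'n) \<Rightarrow> complex" where
  "wirtinger f x Z = (let L = frechet_derivative f (at x); v = fst Z; w = snd Z in
     (L v - \<i> * L (\<i> *s v)) / 2 + (L w + \<i> * L (\<i> *s w)) / 2)"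

text \<open>A chart is a pair of its domain and its coordinate map.\<close>

type_synonym ('m, 'n) chart = "'m set \<times> ('m \<Rightarrow> complex ^ 'n)"

abbreviation chart_inv :: "('m, 'n) chart \<Rightarrow> complex ^ 'n \<Rightarrow> 'm" where
  "chart_inv c \<equiv> inv_into (fst c) (snd c)"

definition chart_trans :: "('m, 'n) chart \<Rightarrow> ('m, 'n) chart \<Rightarrow> complex ^ 'n \<Rightarrow> complex ^ 'n" where
  "chart_trans c c' = snd c' \<circ> chart_inv c"

definition complex_atlas ::
  "('m::{t2_space, second_countable_topology}, 'n::finite) chart set \<Rightarrow> bool" where
  "complex_atlas A \<longleftrightarrow>
     (\<forall>c\<in>A. open (fst c) \<and> open (snd c ` fst c) \<and>
        homeomorphism (fst c) (snd c ` fst c) (snd c) (chart_inv c)) \<and>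
     (\<Union>c\<in>A. fst c) = UNIV \<and>
     (\<forall>c\<in>A. \<forall>c'\<in>A. \<forall>i. holo_on (snd c ` (fst c \<inter> fst c')) (\<lambda>x. chart_trans c c' x $ i))"

definition mholo :: "('m, 'n::finite) chart set \<Rightarrow> 'm set \<Rightarrow> ('m \<Rightarrow> complex) \<Rightarrow> bool" where
  "mholo A V f \<longleftrightarrow> (\<forall>c\<in>A. holo_on (snd c ` (fst c \<inter> V)) (f \<circ> chart_inv c))"

definition msmooth :: "('m, 'n::finite) chart set \<Rightarrow> 'm set \<Rightarrow> ('m \<Rightarrow> complex) \<Rightarrow> bool" where
  "msmooth A V f \<longleftrightarrow> (\<forall>c\<in>A. smooth_on (snd c ` (fst c \<inter> V)) (f \<circ> chart_inv c))"

text \<open>The fibres are complex vector spaces, given as subspaces of an ambient type \<open>'e\<close> with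
  complex scalar multiplication \<open>smul\<close>; as \<open>'e\<close> may be taken to contain the direct sum of all
  fibres, this is no restriction. The total space is the disjoint union of the fibres. Its
  topology and complex structure are the ones induced by the local trivialisations
  \<open>(W, \<tau>) \<in> triv\<close>, where \<open>\<tau> p\<close> is a linear isomorphism from the fibre at \<open>p \<in> W\<close> onto
  complex r-space.\<close>

record ('m, 'e, 'r::finite) vbundle =
  fib :: "'m \<Rightarrow> 'e set"
  triv :: "('m set \<times> ('m \<Rightarrow> 'e \<Rightarrow> complex ^ 'r)) set"
  smul :: "complex \<Rightarrow> 'e \<Rightarrow> 'e"

definition lin_on :: "'a::ab_group_add set \<Rightarrow> (complex \<Rightarrow> 'a \<Rightarrow> 'a) \<Rightarrow>
    (complex \<Rightarrow> 'b::ab_group_add \<Rightarrow> 'b) \<Rightarrow> ('a \<Rightarrow> 'b) \<Rightarrow> bool" where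
  "lin_on S sc sc' f \<longleftrightarrow>
     (\<forall>a\<in>S. \<forall>b\<in>S. f (a + b) = f a + f b) \<and> (\<forall>z. \<forall>a\<in>S. f (sc z a) = sc' z (f a))"

definition holomorphic_bundle :: "('m::{t2_space, second_countable_topology}, 'n::finite) chart set \<Rightarrow>
    ('m, 'e::ab_group_add, 'r::finite) vbundle \<Rightarrow> bool" where
  "holomorphic_bundle A K \<longleftrightarrow>
     vector_space (smul K) \<and> (\<forall>p. module.subspace (smul K) (fib K p)) \<and>
     (\<forall>(W, \<tau>) \<in> triv K. open W \<and>
        (\<forall>p\<in>W. lin_on (fib K p) (smul K) (*s) (\<tau> p) \<and> bij_betw (\<tau> p) (fib K p) UNIV)) \<and>
     (\<Union>b\<in>triv K. fst b) = UNIV \<and>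
     (\<forall>(W, \<tau>) \<in> triv K. \<forall>(W', \<tau>') \<in> triv K. \<forall>i j.
        mholo A (W \<inter> W') (\<lambda>p. \<tau>' p (inv_into (fib K p) (\<tau> p) (axis j 1)) $ i))"

definition smooth_section :: "('m, 'n::finite) chart set \<Rightarrow> ('m, 'e, 'r::finite) vbundle \<Rightarrow>
    'm set \<Rightarrow> ('m \<Rightarrow> 'e) \<Rightarrow> bool" where
  "smooth_section A K V s \<longleftrightarrow>
     (\<forall>p\<in>V. s p \<in> fib K p) \<and> (\<forall>(W, \<tau>) \<in> triv K. \<forall>i. msmooth A (W \<inter> V) (\<lambda>p. \<tau> p (s p) $ i))"

definition holo_section :: "('m, 'n::finite) chart set \<Rightarrow> ('m, 'e, 'r::finite) vbundle \<Rightarrow>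
    'm set \<Rightarrow> ('m \<Rightarrow> 'e) \<Rightarrow> bool" where
  "holo_section A K V s \<longleftrightarrow>
     (\<forall>p\<in>V. s p \<in> fib K p) \<and> (\<forall>(W, \<tau>) \<in> triv K. \<forall>i. mholo A (W \<inter> V) (\<lambda>p. \<tau> p (s p) $ i))"

definition bundle_endo :: "('m, 'e::ab_group_add, 'r::finite) vbundle \<Rightarrow> ('m \<Rightarrow> 'e \<Rightarrow> 'e) \<Rightarrow> bool" where
  "bundle_endo K E \<longleftrightarrow>
     (\<forall>p. E p \<in> fib K p \<rightarrow> fib K p \<and> lin_on (fib K p) (smul K) (smul K) (E p))"

definition smooth_endo :: "('m::topological_space, 'n::finite) chart set \<Rightarrow>
    ('m, 'e::ab_group_add, 'r::finite) vbundle \<Rightarrow> ('m \<Rightarrow> 'e \<Rightarrow> 'e) \<Rightarrow> bool" where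
  "smooth_endo A K E \<longleftrightarrow> bundle_endo K E \<and>
     (\<forall>V s. open V \<longrightarrow> smooth_section A K V s \<longrightarrow> smooth_section A K V (\<lambda>p. E p (s p)))"

definition holo_endo :: "('m::topological_space, 'n::finite) chart set \<Rightarrow>
    ('m, 'e::ab_group_add, 'r::finite) vbundle \<Rightarrow> ('m \<Rightarrow> 'e \<Rightarrow> 'e) \<Rightarrow> bool" where
  "holo_endo A K E \<longleftrightarrow> bundle_endo K E \<and>
     (\<forall>V s. open V \<longrightarrow> holo_section A K V s \<longrightarrow> holo_section A K V (\<lambda>p. E p (s p)))"

definition holo_bundle_iso :: "('m::topological_space, 'n::finite) chart set \<Rightarrow>
    ('m, 'e::ab_group_add, 'r::finite) vbundle \<Rightarrow> ('m, 'f::ab_group_add, 's::finite) vbundle \<Rightarrow>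
    ('m \<Rightarrow> 'e \<Rightarrow> 'f) \<Rightarrow> bool" where
  "holo_bundle_iso A E F f \<longleftrightarrow>
     (\<forall>p. lin_on (fib E p) (smul E) (smul F) (f p) \<and> bij_betw (f p) (fib E p) (fib F p)) \<and>
     (\<forall>V s. open V \<longrightarrow> holo_section A E V s \<longrightarrow> holo_section A F V (\<lambda>p. f p (s p))) \<and>
     (\<forall>V t. open V \<longrightarrow> holo_section A F V t \<longrightarrow>
        holo_section A E V (\<lambda>p. inv_into (fib E p) (f p) (t p)))"

text \<open>A holomorphic tangent vector at \<open>p\<close> is the family of its coordinate vectors in all charts
  around \<open>p\<close>, related by the derivatives of the chart transitions; the value at indices that are
  not charts around \<open>p\<close> is set to 0.\<close>

type_synonym ('m, 'n) tvec = "('m, 'n) chart \<Rightarrow> complex ^ 'n"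

definition tangent_space :: "('m, 'n::finite) chart set \<Rightarrow> 'm \<Rightarrow> ('m, 'n) tvec set" where
  "tangent_space A p =
     {X. (\<forall>c\<in>A. \<forall>c'\<in>A. p \<in> fst c \<inter> fst c' \<longrightarrow>
            X c' = frechet_derivative (chart_trans c c') (at (snd c p)) (X c)) \<and>
         (\<forall>c. \<not> (c \<in> A \<and> p \<in> fst c) \<longrightarrow> X c = 0)}"

definition tangent_bundle :: "('m, 'n::finite) chart set \<Rightarrow> ('m, ('m, 'n) tvec, 'n) vbundle" where
  "tangent_bundle A =
     \<lparr>fib = tangent_space A,
      triv = (\<lambda>c. (fst c, \<lambda>p X. X c)) ` A,
      smul = (\<lambda>z X c. z *s X c)\<rparr>"

text \<open>The pair \<open>(X, Y)\<close> of holomorphic tangent vectors stands for the complexified tangent vector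
  \<open>X + cnj Y\<close>, so the scalar \<open>z\<close> acts on the second component by \<open>cnj z\<close> and conjugation of a
  complexified tangent vector is \<open>prod.swap\<close>.\<close>

type_synonym ('m, 'n) ctvec = "('m, 'n) tvec \<times> ('m, 'n) tvec"

definition ctangent_space :: "('m, 'n::finite) chart set \<Rightarrow> 'm \<Rightarrow> ('m, 'n) ctvec set" where
  "ctangent_space A p = tangent_space A p \<times> tangent_space A p"

definition ctscale :: "complex \<Rightarrow> ('m, 'n::finite) ctvec \<Rightarrow> ('m, 'n) ctvec" where
  "ctscale z Z = ((\<lambda>c. z *s fst Z c), (\<lambda>c. cnj z *s snd Z c))"

definition smooth_cvf :: "('m, 'n::finite) chart set \<Rightarrow> 'm set \<Rightarrow> ('m \<Rightarrow> ('m, 'n) ctvec) \<Rightarrow> bool" where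
  "smooth_cvf A V Z \<longleftrightarrow>
     smooth_section A (tangent_bundle A) V (\<lambda>p. fst (Z p)) \<and>
     smooth_section A (tangent_bundle A) V (\<lambda>p. snd (Z p))"

text \<open>The derivative of a function along a complexified tangent vector at \<open>p\<close>; it does not depend
  on the chart.\<close>

definition cderiv :: "('m, 'n::finite) chart set \<Rightarrow> 'm \<Rightarrow> ('m, 'n) ctvec \<Rightarrow> ('m \<Rightarrow> complex) \<Rightarrow> complex" where
  "cderiv A p Z f = (let c = (SOME c. c \<in> A \<and> p \<in> fst c) in
     wirtinger (f \<circ> chart_inv c) (snd c p) (fst Z c, snd Z c))"

text \<open>In coordinates the components of the Lie bracket of \<open>Z\<close> and \<open>W\<close> are \<open>Z(W_k) - W(Z_k)\<close>. The
  conjugations in the second component come from the encoding of the (0,1)-part.\<close>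

definition lie_bracket :: "('m, 'n::finite) chart set \<Rightarrow> ('m \<Rightarrow> ('m, 'n) ctvec) \<Rightarrow>
    ('m \<Rightarrow> ('m, 'n) ctvec) \<Rightarrow> 'm \<Rightarrow> ('m, 'n) ctvec" where
  "lie_bracket A Z W p =
     ((\<lambda>c. if c \<in> A \<and> p \<in> fst c then
         (\<chi> k. cderiv A p (Z p) (\<lambda>q. fst (W q) c $ k) - cderiv A p (W p) (\<lambda>q. fst (Z q) c $ k))
       else 0),
      (\<lambda>c. if c \<in> A \<and> p \<in> fst c then
         (\<chi> k. cnj (cderiv A p (Z p) (\<lambda>q. cnj (snd (W q) c $ k))
                  - cderiv A p (W p) (\<lambda>q. cnj (snd (Z q) c $ k))))
       else 0))"

text \<open>A connection is given by \<open>D s p v\<close>, the covariant derivative at \<open>p\<close> of a section \<open>s\<close>, defined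
  and smooth near \<open>p\<close>, in the direction of the complexified tangent vector \<open>v\<close>. Hence
  \<open>\<lambda>p. D s p (X p, 0)\<close> is the derivative of \<open>s\<close> along \<open>X\<close>, and \<open>\<lambda>p. D s p (0, X p)\<close> the one along
  the conjugate of \<open>X\<close>.\<close>

type_synonym ('m, 'n, 'e) conn = "('m \<Rightarrow> 'e) \<Rightarrow> 'm \<Rightarrow> ('m, 'n) ctvec \<Rightarrow> 'e"

definition connection :: "('m::topological_space, 'n::finite) chart set \<Rightarrow>
    ('m, 'e::ab_group_add, 'r::finite) vbundle \<Rightarrow> ('m, 'n, 'e) conn \<Rightarrow> bool" where
  "connection A K D \<longleftrightarrow>
     (\<forall>V s. open V \<longrightarrow> smooth_section A K V s \<longrightarrow>
        (\<forall>Z. smooth_cvf A V Z \<longrightarrow> smooth_section A K V (\<lambda>p. D s p (Z p))) \<and>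
        (\<forall>p\<in>V. D s p \<in> ctangent_space A p \<rightarrow> fib K p \<and>
           lin_on (ctangent_space A p) ctscale (smul K) (D s p)) \<and>
        (\<forall>t. smooth_section A K V t \<longrightarrow> (\<forall>p\<in>V. \<forall>v\<in>ctangent_space A p.
           D (\<lambda>q. s q + t q) p v = D s p v + D t p v)) \<and>
        (\<forall>f. msmooth A V f \<longrightarrow> (\<forall>p\<in>V. \<forall>v\<in>ctangent_space A p.
           D (\<lambda>q. smul K (f q) (s q)) p v
             = smul K (f p) (D s p v) + smul K (cderiv A p v f) (s p))) \<and>
        (\<forall>t. (\<forall>q\<in>V. s q = t q) \<longrightarrow> (\<forall>p\<in>V. \<forall>v\<in>ctangent_space A p. D s p v = D t p v)))"

text \<open>The two conditions on the connection: its (0,1)-part is the Dolbeault operator of the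
  holomorphic bundle, and the hermitian form \<open>h\<close> is parallel.\<close>

definition chern_connection :: "('m::topological_space, 'n::finite) chart set \<Rightarrow>
    ('m, 'e::ab_group_add, 'r::finite) vbundle \<Rightarrow> ('m \<Rightarrow> 'e \<Rightarrow> 'e \<Rightarrow> complex) \<Rightarrow>
    ('m, 'n, 'e) conn \<Rightarrow> bool" where
  "chern_connection A K h D \<longleftrightarrow> connection A K D \<and>
     (\<forall>V s. open V \<longrightarrow> smooth_section A K V s \<longrightarrow>
        (\<forall>(W, \<tau>) \<in> triv K. \<forall>p \<in> W \<inter> V. \<forall>Y \<in> tangent_space A p. \<forall>i.
           \<tau> p (D s p (0, Y)) $ i = cderiv A p (0, Y) (\<lambda>q. \<tau> q (s q) $ i))) \<and>
     (\<forall>V s t. open V \<longrightarrow> smooth_section A K V s \<longrightarrow> smooth_section A K V t \<longrightarrow>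
        (\<forall>p\<in>V. \<forall>v\<in>ctangent_space A p.
           cderiv A p v (\<lambda>q. h q (s q) (t q)) = h p (D s p v) (t p) + h p (s p) (D t p (prod.swap v))))"

definition curvature :: "('m, 'n::finite) chart set \<Rightarrow> ('m, 'n, 'e::ab_group_add) conn \<Rightarrow>
    ('m \<Rightarrow> ('m, 'n) ctvec) \<Rightarrow> ('m \<Rightarrow> ('m, 'n) ctvec) \<Rightarrow> ('m \<Rightarrow> 'e) \<Rightarrow> 'm \<Rightarrow> 'e" where
  "curvature A D Z W s p =
     D (\<lambda>q. D s q (W q)) p (Z p) - D (\<lambda>q. D s q (Z q)) p (W p) - D s p (lie_bracket A Z W p)"

text \<open>The induced covariant derivative of an endomorphism \<open>E\<close> (defined and smooth near \<open>p\<close>), as an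
  endomorphism of the fibre at \<open>p\<close>: extend \<open>a\<close> to a smooth local section \<open>s\<close> and apply the product
  rule. The result does not depend on \<open>s\<close>.\<close>

definition cov_endo :: "('m::topological_space, 'n::finite) chart set \<Rightarrow>
    ('m, 'e::ab_group_add, 'r::finite) vbundle \<Rightarrow> ('m, 'n, 'e) conn \<Rightarrow> ('m \<Rightarrow> 'e \<Rightarrow> 'e) \<Rightarrow>
    'm \<Rightarrow> ('m, 'n) ctvec \<Rightarrow> 'e \<Rightarrow> 'e" where
  "cov_endo A K D E p v a =
     (let s = (SOME s. s p = a \<and> (\<exists>V. open V \<and> p \<in> V \<and> smooth_section A K V s)) in
        D (\<lambda>q. E q (s q)) p v - E p (D s p v))"

definition commutator :: "('e::ab_group_add \<Rightarrow> 'e) \<Rightarrow> ('e \<Rightarrow> 'e) \<Rightarrow> 'e \<Rightarrow> 'e" where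
  "commutator E F a = E (F a) - F (E a)"

locale cv_structure =
  fixes A :: "('m::{t2_space, second_countable_topology}, 'n::finite) chart set"
    and K :: "('m, 'e::ab_group_add, 'r::finite) vbundle"
    and C :: "'m \<Rightarrow> ('m, 'n) tvec \<Rightarrow> 'e \<Rightarrow> 'e"
    and U :: "'m \<Rightarrow> 'e \<Rightarrow> 'e"
    and g :: "'m \<Rightarrow> 'e \<Rightarrow> 'e \<Rightarrow> complex"
    and \<kappa> :: "'m \<Rightarrow> 'e \<Rightarrow> 'e"
    and h :: "'m \<Rightarrow> 'e \<Rightarrow> 'e \<Rightarrow> complex"
    and D :: "('m, 'n, 'e) conn"
    and Q :: "'m \<Rightarrow> 'e \<Rightarrow> 'e"
  assumes manifold: "complex_atlas A"
    and holo_bundle: "holomorphic_bundle A K"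
    and C_endo: "\<And>p X. X \<in> tangent_space A p \<Longrightarrow>
      C p X \<in> fib K p \<rightarrow> fib K p \<and> lin_on (fib K p) (smul K) (smul K) (C p X)"
    and C_linear: "\<And>p a. a \<in> fib K p \<Longrightarrow>
      lin_on (tangent_space A p) (smul (tangent_bundle A)) (smul K) (\<lambda>X. C p X a)"
    and C_holomorphic: "\<And>V X s. \<lbrakk>open V; holo_section A (tangent_bundle A) V X; holo_section A K V s\<rbrakk>
      \<Longrightarrow> holo_section A K V (\<lambda>p. C p (X p) (s p))"
    and U_holomorphic: "holo_endo A K U"
    and g_symmetric: "\<And>p a b. \<lbrakk>a \<in> fib K p; b \<in> fib K p\<rbrakk> \<Longrightarrow> g p a b = g p b a"
    and g_linear: "\<And>p b. b \<in> fib K p \<Longrightarrow> lin_on (fib K p) (smul K) (*) (\<lambda>a. g p a b)"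
    and g_nondegenerate: "\<And>p a. \<lbrakk>a \<in> fib K p; \<forall>b \<in> fib K p. g p a b = 0\<rbrakk> \<Longrightarrow> a = 0"
    and g_holomorphic: "\<And>V s t. \<lbrakk>open V; holo_section A K V s; holo_section A K V t\<rbrakk>
      \<Longrightarrow> mholo A V (\<lambda>p. g p (s p) (t p))"
    and C_commute: "\<And>p X Y a. \<lbrakk>X \<in> tangent_space A p; Y \<in> tangent_space A p; a \<in> fib K p\<rbrakk>
      \<Longrightarrow> C p X (C p Y a) = C p Y (C p X a)"
    and C_U_commute: "\<And>p X a. \<lbrakk>X \<in> tangent_space A p; a \<in> fib K p\<rbrakk>
      \<Longrightarrow> commutator (C p X) (U p) a = 0"
    and C_selfadjoint: "\<And>p X a b. \<lbrakk>X \<in> tangent_space A p; a \<in> fib K p; b \<in> fib K p\<rbrakk>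
      \<Longrightarrow> g p (C p X a) b = g p a (C p X b)"
    and U_selfadjoint: "\<And>p a b. \<lbrakk>a \<in> fib K p; b \<in> fib K p\<rbrakk> \<Longrightarrow> g p (U p a) b = g p a (U p b)"
    and \<kappa>_fibre: "\<And>p. \<kappa> p \<in> fib K p \<rightarrow> fib K p"
    and \<kappa>_antilinear: "\<And>p. lin_on (fib K p) (smul K) (\<lambda>z. smul K (cnj z)) (\<kappa> p)"
    and \<kappa>_smooth: "\<And>V s. \<lbrakk>open V; smooth_section A K V s\<rbrakk>
      \<Longrightarrow> smooth_section A K V (\<lambda>p. \<kappa> p (s p))"
    and \<kappa>_involution: "\<And>p a. a \<in> fib K p \<Longrightarrow> \<kappa> p (\<kappa> p a) = a"
    and \<kappa>_real: "\<And>p a b. \<lbrakk>a \<in> fib K p; b \<in> fib K p\<rbrakk> \<Longrightarrow> g p (\<kappa> p a) (\<kappa> p b) = cnj (g p a b)"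
    and h_def: "\<And>p a b. \<lbrakk>a \<in> fib K p; b \<in> fib K p\<rbrakk> \<Longrightarrow> h p a b = g p a (\<kappa> p b)"
    and h_linear: "\<And>p b. b \<in> fib K p \<Longrightarrow> lin_on (fib K p) (smul K) (*) (\<lambda>a. h p a b)"
    and h_hermitian: "\<And>p a b. \<lbrakk>a \<in> fib K p; b \<in> fib K p\<rbrakk> \<Longrightarrow> h p b a = cnj (h p a b)"
    and h_nondegenerate: "\<And>p a. \<lbrakk>a \<in> fib K p; \<forall>b \<in> fib K p. h p a b = 0\<rbrakk> \<Longrightarrow> a = 0"
    and D_chern: "chern_connection A K h D"
    and D_\<kappa>: "\<And>V X s p. \<lbrakk>open V; p \<in> V; holo_section A (tangent_bundle A) V X; smooth_section A K V s\<rbrakk>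
      \<Longrightarrow> D (\<lambda>q. \<kappa> q (s q)) p (X p, 0) = \<kappa> p (D s p (0, X p))"
    and D_C: "\<And>V X Y p a. \<lbrakk>open V; p \<in> V; holo_section A (tangent_bundle A) V X;
        holo_section A (tangent_bundle A) V Y; a \<in> fib K p\<rbrakk>
      \<Longrightarrow> cov_endo A K D (\<lambda>q. C q (Y q)) p (X p, 0) a
          - cov_endo A K D (\<lambda>q. C q (X q)) p (Y p, 0) a
          - C p (fst (lie_bracket A (\<lambda>q. (X q, 0)) (\<lambda>q. (Y q, 0)) p)) a = 0"
    and D_curvature: "\<And>V X Y s p. \<lbrakk>open V; p \<in> V; holo_section A (tangent_bundle A) V X;
        holo_section A (tangent_bundle A) V Y; smooth_section A K V s\<rbrakk>
      \<Longrightarrow> curvature A D (\<lambda>q. (X q, 0)) (\<lambda>q. (0, Y q)) s p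
          + commutator (C p (X p)) (\<kappa> p \<circ> C p (Y p) \<circ> \<kappa> p) (s p) = 0"
    and Q_smooth: "smooth_endo A K Q"
    and Q_g_skew: "\<And>p a b. \<lbrakk>a \<in> fib K p; b \<in> fib K p\<rbrakk> \<Longrightarrow> g p (Q p a) b = - g p a (Q p b)"
    and Q_h_selfadjoint: "\<And>p a b. \<lbrakk>a \<in> fib K p; b \<in> fib K p\<rbrakk> \<Longrightarrow> h p (Q p a) b = h p a (Q p b)"
    and D_U: "\<And>V X p a. \<lbrakk>open V; p \<in> V; holo_section A (tangent_bundle A) V X; a \<in> fib K p\<rbrakk>
      \<Longrightarrow> cov_endo A K D U p (X p, 0) a - commutator (C p (X p)) (Q p) a + C p (X p) a = 0"
    and D_Q: "\<And>V X p a. \<lbrakk>open V; p \<in> V; holo_section A (tangent_bundle A) V X; a \<in> fib K p\<rbrakk>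
      \<Longrightarrow> cov_endo A K D Q p (X p, 0) a + commutator (C p (X p)) (\<kappa> p \<circ> U p \<circ> \<kappa> p) a = 0"

definition unfold_iso :: "('m \<Rightarrow> ('m, 'n) tvec \<Rightarrow> 'e \<Rightarrow> 'e::ab_group_add) \<Rightarrow> ('m \<Rightarrow> 'e) \<Rightarrow>
    'm \<Rightarrow> ('m, 'n) tvec \<Rightarrow> 'e" where
  "unfold_iso C \<zeta> p X = - C p X (\<zeta> p)"

definition primitive_section :: "('m::topological_space, 'n::finite) chart set \<Rightarrow>
    ('m, 'e::ab_group_add, 'r::finite) vbundle \<Rightarrow> ('m \<Rightarrow> ('m, 'n) tvec \<Rightarrow> 'e \<Rightarrow> 'e) \<Rightarrow>
    ('m \<Rightarrow> 'e) \<Rightarrow> bool" where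
  "primitive_section A K C \<zeta> \<longleftrightarrow>
     holo_section A K UNIV \<zeta> \<and> holo_bundle_iso A (tangent_bundle A) K (unfold_iso C \<zeta>)"

definition DU_endo :: "('m::topological_space, 'n::finite) chart set \<Rightarrow>
    ('m, 'e::ab_group_add, 'r::finite) vbundle \<Rightarrow> ('m, 'n, 'e) conn \<Rightarrow>
    ('m \<Rightarrow> ('m, 'n) tvec \<Rightarrow> 'e \<Rightarrow> 'e) \<Rightarrow> ('m \<Rightarrow> 'e \<Rightarrow> 'e) \<Rightarrow> ('m \<Rightarrow> 'e) \<Rightarrow> 'm \<Rightarrow> 'e \<Rightarrow> 'e" where
  "DU_endo A K D C U \<zeta> p a =
     cov_endo A K D U p (inv_into (tangent_space A p) (unfold_iso C \<zeta> p) a, 0) (\<zeta> p)"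

text \<open>The adjoint with respect to \<open>g\<close>; it exists and is unique because \<open>g\<close> is non-degenerate and the
  fibres are finite-dimensional.\<close>

definition g_adjoint :: "('m, 'e, 'r::finite) vbundle \<Rightarrow> ('m \<Rightarrow> 'e \<Rightarrow> 'e \<Rightarrow> complex) \<Rightarrow>
    ('m \<Rightarrow> 'e \<Rightarrow> 'e) \<Rightarrow> 'm \<Rightarrow> 'e \<Rightarrow> 'e" where
  "g_adjoint K g E p b = (THE b'. b' \<in> fib K p \<and> (\<forall>a\<in>fib K p. g p (E p a) b = g p a b'))"

definition skew_part :: "('m, 'e::ab_group_add, 'r::finite) vbundle \<Rightarrow> ('m \<Rightarrow> 'e \<Rightarrow> 'e \<Rightarrow> complex) \<Rightarrow>
    ('m \<Rightarrow> 'e \<Rightarrow> 'e) \<Rightarrow> 'm \<Rightarrow> 'e \<Rightarrow> 'e" where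
  "skew_part K g E p a = smul K (1 / 2) (E p a - g_adjoint K g E p a)"

end

theory Submission
  imports Defs
begin

text \<open>For \<open>s\<close> in a fibre put \<open>X = I\<^sup>-\<^sup>1 s\<close>, so that \<open>C\<^sub>X \<zeta> = -s\<close>. The equation
  \<open>D\<^sub>X(\<U>) = [C\<^sub>X, \<Q>] - C\<^sub>X\<close>, applied to \<open>\<zeta>\<close>, gives \<open>D\<^sub>X(\<U>)(\<zeta>) = \<Q> s + s + C\<^sub>X(\<Q> \<zeta>)\<close>.
  With \<open>Y = I\<^sup>-\<^sup>1(\<Q> \<zeta>)\<close> commutativity turns the last summand into \<open>C\<^sub>Y s\<close>. Since \<open>\<Q>\<close> is
  g-skew and \<open>id + C\<^sub>Y\<close> is g-symmetric, the skew part is \<open>\<Q>\<close>.\<close>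

lemma lin_on_uminus:
  assumes "vector_space sc" "vector_space sc'" "lin_on S sc sc' f" "a \<in> S"
  shows "f (- a) = - f a"
proof -
  interpret A: vector_space sc by fact
  interpret B: vector_space sc' by fact
  have "f (sc (- 1) a) = sc' (- 1) (f a)"
    using assms(3,4) by (auto simp only: lin_on_def)
  then show ?thesis by simp
qed

text \<open>A section with constant coefficients in a local frame has, in any other trivialisation,
  components of this form, the \<open>f j\<close> being entries of the transition matrix.\<close>

lemma holo_on_linear_combination:
  assumes "\<And>j. j \<in> J \<Longrightarrow> holo_on S (f j)"
  shows "holo_on S (\<lambda>x. \<Sum>j\<in>J. a j * f j x)"
  unfolding holo_on_def
proof
  fix x assume "x \<in> S"
  then have "\<forall>j\<in>J. \<exists>L. (f j has_derivative L) (at x) \<and> (\<forall>c v. L (c *s v) = c * L v)"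
    using assms by (auto simp: holo_on_def)
  then obtain L where L: "\<And>j. j \<in> J \<Longrightarrow> (f j has_derivative L j) (at x)"
      "\<And>j c v. j \<in> J \<Longrightarrow> L j (c *s v) = c * L j v"
    by metis
  have "((\<lambda>x. \<Sum>j\<in>J. a j * f j x) has_derivative (\<lambda>v. \<Sum>j\<in>J. a j * L j v)) (at x)"
    by (intro has_derivative_sum has_derivative_mult_right L)
  moreover have "(\<Sum>j\<in>J. a j * L j (c *s v)) = c * (\<Sum>j\<in>J. a j * L j v)" for c v
    by (simp add: L sum_distrib_left algebra_simps)
  ultimately show "\<exists>L. ((\<lambda>x. \<Sum>j\<in>J. a j * f j x) has_derivative L) (at x) \<and>
      (\<forall>c v. L (c *s v) = c * L v)"
    by blast
qed

text \<open>The derivatives in \<open>holo_on\<close> are taken in the full space, so agreement on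
  \<open>S\<close> alone passes them on only because \<open>S\<close> is a neighbourhood of each of
  its points.\<close>

lemma holo_on_cong:
  assumes "open S" "\<And>x. x \<in> S \<Longrightarrow> f x = f' x" "holo_on S f"
  shows "holo_on S f'"
  unfolding holo_on_def
proof
  fix x assume x: "x \<in> S"
  then obtain L where "(f has_derivative L) (at x)" "\<forall>c v. L (c *s v) = c * L v"
    using assms(3) by (auto simp: holo_on_def)
  moreover from this(1) have "(f' has_derivative L) (at x)"
    by (rule has_derivative_transform_within_open[OF _ assms(1) x]) (use assms(2) in auto)
  ultimately show "\<exists>L. (f' has_derivative L) (at x) \<and> (\<forall>c v. L (c *s v) = c * L v)"
    by blast
qed

text \<open>A chart is a homeomorphism onto its image, so the set is relatively open in that image,
  which is itself open. This supplies the openness that \<open>holo_on_cong\<close> asks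
  for.\<close>

lemma open_chart_image:
  assumes "complex_atlas A" "c \<in> A" "open V"
  shows "open (snd c ` (fst c \<inter> V))"
proof -
  have c: "open (snd c ` fst c)" "homeomorphism (fst c) (snd c ` fst c) (snd c) (chart_inv c)"
    using assms(1,2) by (auto simp: complex_atlas_def)
  have "openin (top_of_set (snd c ` fst c)) (snd c ` (fst c \<inter> V))"
    by (rule homeomorphism_imp_open_map[OF c(2)]) (use assms(3) in auto)
  then show ?thesis
    using c(1) openin_open_trans by blast
qed

text \<open>The witness is constant in a trivialisation.\<close>

lemma ex_holo_section:
  fixes K :: "('m::{t2_space, second_countable_topology}, 'e::ab_group_add, 'r::finite) vbundle"
  assumes A: "complex_atlas A" and K: "holomorphic_bundle A K" and a: "a \<in> fib K p"
  obtains V s where "open V" "p \<in> V" "holo_section A K V s" "s p = a"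
proof -
  interpret vector_space "smul K" using K by (simp add: holomorphic_bundle_def)
  have "p \<in> (\<Union>b\<in>triv K. fst b)" using K by (simp add: holomorphic_bundle_def)
  then obtain V \<tau> where V: "(V, \<tau>) \<in> triv K" "p \<in> V" by auto
  have sub: "\<And>q. subspace (fib K q)"
    using K by (simp add: holomorphic_bundle_def)
  have triv: "open W \<and> (\<forall>q\<in>W. lin_on (fib K q) (smul K) (*s) (\<tau>' q) \<and>
      bij_betw (\<tau>' q) (fib K q) UNIV)" if W: "(W, \<tau>') \<in> triv K" for W \<tau>'
  proof -
    have "\<forall>(W, \<tau>) \<in> triv K. open W \<and>
        (\<forall>p\<in>W. lin_on (fib K p) (smul K) (*s) (\<tau> p) \<and> bij_betw (\<tau> p) (fib K p) UNIV)"
      using K unfolding holomorphic_bundle_def by (elim conjE)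
    from bspec[OF this W] show ?thesis by simp
  qed
  have oV: "open V" and bij: "\<And>q. q \<in> V \<Longrightarrow> bij_betw (\<tau> q) (fib K q) UNIV"
    using triv[OF V(1)] by auto
  have trans: "mholo A (V \<inter> W) (\<lambda>p. \<tau>' p (inv_into (fib K p) (\<tau> p) (axis j 1)) $ i)"
    if W: "(W, \<tau>') \<in> triv K" for W \<tau>' i j
  proof -
    have "\<forall>(W, \<tau>) \<in> triv K. \<forall>(W', \<tau>') \<in> triv K. \<forall>i j.
        mholo A (W \<inter> W') (\<lambda>p. \<tau>' p (inv_into (fib K p) (\<tau> p) (axis j 1)) $ i)"
      using K unfolding holomorphic_bundle_def by (elim conjE)
    from bspec[OF this V(1)] W show ?thesis by fastforce
  qed
  have opn: "open W" if "(W, \<tau>') \<in> triv K" for W \<tau>'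
    using triv[OF that] by simp
  have lin: "lin_on (fib K q) (smul K) (*s) (\<tau>' q)" if "(W, \<tau>') \<in> triv K" "q \<in> W" for W \<tau>' q
    using triv[OF that(1)] that(2) by simp
  \<comment> \<open>The local frame that \<open>\<tau>\<close> turns into the standard basis; its
    components in a second trivialisation are the transition functions, holomorphic by
    \<open>trans\<close>.\<close>
  define e where "e j q = inv_into (fib K q) (\<tau> q) (axis j 1)" for j q
  have e: "e j q \<in> fib K q" "\<tau> q (e j q) = axis j 1" if "q \<in> V" for j q
    unfolding e_def
    using bij_betwE[OF bij_betw_inv_into[OF bij[OF that]]]
      bij_betw_inv_into_right[OF bij[OF that] UNIV_I] by simp_all
  \<comment> \<open>The coefficients are frozen at \<open>p\<close>, which forces the value
    \<open>a\<close> there.\<close>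
  define s where "s q = (\<Sum>j\<in>UNIV. smul K (\<tau> p a $ j) (e j q))" for q
  have s_fib: "s q \<in> fib K q" if "q \<in> V" for q
    unfolding s_def using e(1)[OF that] by (intro subspace_sum subspace_scale sub)
  have s_lin: "f (s q) = (\<Sum>j\<in>UNIV. \<tau> p a $ j *s f (e j q))"
    if q: "q \<in> V" and f: "lin_on (fib K q) (smul K) (*s) f" for f :: "'e \<Rightarrow> complex ^ 'r" and q
  proof -
    have "f (0 + 0) = f 0 + f 0"
      using f subspace_0[OF sub[of q]] unfolding lin_on_def by blast
    then have "f 0 = 0" by simp
    \<comment> \<open>Additivity of \<open>f\<close> is available only inside the fibre, so the
      induction carries membership of the partial sums along.\<close>
    have "(\<Sum>j\<in>J. smul K (\<tau> p a $ j) (e j q)) \<in> fib K q \<and>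
        f (\<Sum>j\<in>J. smul K (\<tau> p a $ j) (e j q)) = (\<Sum>j\<in>J. \<tau> p a $ j *s f (e j q))"
      if "finite J" for J
      using that
    proof induction
      case empty
      show ?case using \<open>f 0 = 0\<close> sub[of q] by (simp add: subspace_0)
    next
      case (insert k J)
      have "smul K (\<tau> p a $ k) (e k q) \<in> fib K q"
        using e(1)[OF q] sub[of q] by (simp add: subspace_scale)
      then show ?case using insert f e(1)[OF q] sub[of q]
        by (simp add: lin_on_def subspace_add)
    qed
    then show ?thesis unfolding s_def by simp
  qed
  have "\<tau> p (s p) = \<tau> p a"
    unfolding s_lin[OF V(2) lin[OF V]] e(2)[OF V(2)] by (rule basis_expansion)
  then have "s p = a"
    using bij[OF V(2)] a s_fib[OF V(2)] by (auto simp: bij_betw_def dest: inj_onD)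
  moreover have "holo_section A K V s"
    unfolding holo_section_def mholo_def
  proof (clarsimp simp: s_fib simp del: o_apply)
    fix W \<tau>' i d d' assume W: "(W, \<tau>') \<in> triv K" and c: "(d, d') \<in> A"
    show "holo_on (d' ` (d \<inter> (W \<inter> V))) ((\<lambda>q. \<tau>' q (s q) $ i) \<circ> inv_into d d')"
    proof (rule holo_on_cong)
      show "open (d' ` (d \<inter> (W \<inter> V)))"
        using open_chart_image[OF A c, of "W \<inter> V"] opn[OF W] oV by (simp add: open_Int)
      show "holo_on (d' ` (d \<inter> (W \<inter> V)))
          (\<lambda>x. \<Sum>j\<in>UNIV. \<tau> p a $ j * ((\<lambda>q. \<tau>' q (e j q) $ i) \<circ> inv_into d d') x)"
      proof (rule holo_on_linear_combination)
        fix j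
        from trans[OF W, of j i] c
        show "holo_on (d' ` (d \<inter> (W \<inter> V))) ((\<lambda>q. \<tau>' q (e j q) $ i) \<circ> inv_into d d')"
          unfolding mholo_def e_def Int_commute[of W V] by fastforce
      qed
      fix x assume "x \<in> d' ` (d \<inter> (W \<inter> V))"
      then obtain q where q: "q \<in> d" "q \<in> W" "q \<in> V" "x = d' q" by auto
      have "inj_on d' d"
        using A c by (force simp: complex_atlas_def homeomorphism_def intro: inj_on_inverseI)
      then have "inv_into d d' x = q" using q by simp
      then show "(\<Sum>j\<in>UNIV. \<tau> p a $ j * ((\<lambda>q. \<tau>' q (e j q) $ i) \<circ> inv_into d d') x) =
          ((\<lambda>q. \<tau>' q (s q) $ i) \<circ> inv_into d d') x"
        using s_lin[OF q(3) lin[OF W q(2)]] by simp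
    qed
  qed
  ultimately show ?thesis using that oV V(2) by blast
qed

text \<open>Two candidates for the adjoint pair equally with every \<open>a\<close>, so
  non-degeneracy makes their difference vanish. An adjoint can thus be computed by exhibiting
  it.\<close>

lemma g_adjoint_eqI:
  assumes "vector_space (smul K)" "module.subspace (smul K) (fib K p)"
    and sym: "\<And>a b. \<lbrakk>a \<in> fib K p; b \<in> fib K p\<rbrakk> \<Longrightarrow> g p a b = g p b a"
    and lin: "\<And>b. b \<in> fib K p \<Longrightarrow> lin_on (fib K p) (smul K) (*) (\<lambda>a. g p a b)"
    and nondeg: "\<And>a. \<lbrakk>a \<in> fib K p; \<forall>b \<in> fib K p. g p a b = 0\<rbrakk> \<Longrightarrow> a = 0"
    and b': "b' \<in> fib K p" and adj: "\<And>a. a \<in> fib K p \<Longrightarrow> g p (E p a) b = g p a b'"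
  shows "g_adjoint K g E p b = b'"
  unfolding g_adjoint_def
proof (rule the_equality)
  interpret vector_space "smul K" by fact
  fix x assume x: "x \<in> fib K p \<and> (\<forall>a\<in>fib K p. g p (E p a) b = g p a x)"
  have d: "x - b' \<in> fib K p" using x b' assms(2) by (simp add: subspace_diff)
  have "g p (x - b') a = 0" if a: "a \<in> fib K p" for a
  proof -
    have "g p (x - b' + b') a = g p (x - b') a + g p b' a"
      using lin[OF a] d b' by (simp only: lin_on_def)
    moreover have "g p x a = g p b' a"
      using x adj[OF a] a b' sym by metis
    ultimately show ?thesis by simp
  qed
  then show "x = b'" using nondeg[OF d] by simp
qed (use b' adj in auto)

context cv_structure
begin

text \<open>\<open>D_U\<close> speaks of holomorphic vector fields, whereas \<open>DU_endo\<close>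
  involves a single tangent vector. Extending \<open>s\<close> to a local holomorphic section and
  applying the holomorphic inverse of \<open>unfold_iso\<close> yields a field through that
  vector.\<close>

lemma DU_endo_eq:
  assumes \<zeta>: "primitive_section A K C \<zeta>" and s: "s \<in> fib K p"
    and Y: "Y \<in> tangent_space A p" "unfold_iso C \<zeta> p Y = Q p (\<zeta> p)"
  shows "DU_endo A K D C U \<zeta> p s = Q p s + s + C p Y s"
proof -
  let ?I = "unfold_iso C \<zeta>"
  have vs: "vector_space (smul K)"
    using holo_bundle by (simp add: holomorphic_bundle_def)
  have iso: "holo_bundle_iso A (tangent_bundle A) K ?I" and \<zeta>p: "\<zeta> p \<in> fib K p"
    using \<zeta> by (auto simp: primitive_section_def holo_section_def)
  obtain V t where V: "open V" "p \<in> V" and t: "holo_section A K V t" "t p = s"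
    using ex_holo_section[OF manifold holo_bundle s] .
  define X where "X q = inv_into (tangent_space A q) (?I q) (t q)" for q
  have X: "holo_section A (tangent_bundle A) V X"
    using iso V(1) t(1) by (simp add: holo_bundle_iso_def X_def[abs_def] tangent_bundle_def)
  have bij: "bij_betw (?I p) (tangent_space A p) (fib K p)"
    using iso by (simp add: holo_bundle_iso_def tangent_bundle_def)
  have Xp: "X p \<in> tangent_space A p" "?I p (X p) = s"
    unfolding X_def t(2)
    using bij_betwE[OF bij_betw_inv_into[OF bij]] s bij_betw_inv_into_right[OF bij s]
    by simp_all
  have CX: "C p (X p) (\<zeta> p) = - s" and CY: "C p Y (\<zeta> p) = - Q p (\<zeta> p)"
    by (simp_all add: unfold_iso_def flip: Xp(2) Y(2))
  have Qs: "Q p (- s) = - Q p s"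
    using lin_on_uminus[OF vs vs _ s] Q_smooth by (simp add: smooth_endo_def bundle_endo_def)
  have CYs: "C p Y (- s) = - C p Y s"
    using lin_on_uminus[OF vs vs _ s] C_endo[OF Y(1)] by simp
  \<comment> \<open>The aim is to move \<open>Q\<close> off the primitive section: write its image
    as \<open>- C p Y (\<zeta> p)\<close>, commute the two operators, and use \<open>CX\<close>; the
    two signs cancel.\<close>
  have "C p Y (\<zeta> p) \<in> fib K p" using C_endo[OF Y(1)] \<zeta>p by auto
  then have "C p (X p) (- C p Y (\<zeta> p)) = - C p (X p) (C p Y (\<zeta> p))"
    using lin_on_uminus[OF vs vs] C_endo[OF Xp(1)] by blast
  also have "\<dots> = C p Y s"
    using C_commute[OF Xp(1) Y(1) \<zeta>p] CX CYs by simp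
  finally have CXQ: "C p (X p) (Q p (\<zeta> p)) = C p Y s" using CY by simp
  have "cov_endo A K D U p (X p, 0) (\<zeta> p)
      - (C p (X p) (Q p (\<zeta> p)) - Q p (C p (X p) (\<zeta> p))) + C p (X p) (\<zeta> p) = 0"
    using D_U[OF V X \<zeta>p] by (simp add: commutator_def)
  then have "cov_endo A K D U p (X p, 0) (\<zeta> p) = Q p s + s + C p Y s"
    unfolding CXQ CX Qs by (simp add: algebra_simps)
  then show ?thesis by (simp add: DU_endo_def X_def t(2))
qed

lemma Q_eq_skew_part:
  assumes \<zeta>: "primitive_section A K C \<zeta>" and s: "s \<in> fib K p"
  shows "Q p s = skew_part K g (DU_endo A K D C U \<zeta>) p s"
proof -
  let ?E = "DU_endo A K D C U \<zeta>"
  have vs: "vector_space (smul K)" and sub: "module.subspace (smul K) (fib K p)"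
    using holo_bundle by (auto simp: holomorphic_bundle_def)
  interpret vector_space "smul K" by fact
  have \<zeta>p: "\<zeta> p \<in> fib K p"
    and bij: "bij_betw (unfold_iso C \<zeta> p) (tangent_space A p) (fib K p)"
    using \<zeta> by (auto simp: primitive_section_def holo_section_def holo_bundle_iso_def
        tangent_bundle_def)
  have Q: "Q p a \<in> fib K p" if "a \<in> fib K p" for a
    using Q_smooth that by (auto simp: smooth_endo_def bundle_endo_def)
  \<comment> \<open>\<open>Y\<close> depends on \<open>p\<close> only. One choice describes
    \<open>?E\<close> on the whole fibre, as the adjoint condition, which runs over all
    \<open>a\<close>, requires.\<close>
  obtain Y where Y: "Y \<in> tangent_space A p" "unfold_iso C \<zeta> p Y = Q p (\<zeta> p)"
    using bij Q[OF \<zeta>p] by (metis bij_betw_imp_surj_on imageE)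
  have E: "?E p a = Q p a + a + C p Y a" if "a \<in> fib K p" for a
    using DU_endo_eq[OF \<zeta> that Y] .
  have CY: "C p Y a \<in> fib K p" if "a \<in> fib K p" for a
    using C_endo[OF Y(1)] that by auto
  \<comment> \<open>\<open>g_linear\<close> concerns the first argument; symmetry carries it to the
    second.\<close>
  have plus: "g p (a + b) c = g p a c + g p b c" "g p c (a + b) = g p c a + g p c b"
    if "a \<in> fib K p" "b \<in> fib K p" "c \<in> fib K p" for a b c
  proof -
    show *: "g p (a + b) c = g p a c + g p b c"
      using g_linear[OF that(3)] that by (simp add: lin_on_def)
    show "g p c (a + b) = g p c a + g p c b"
      using * that sub by (simp add: g_symmetric[of c] subspace_add)
  qed
  have uminus: "g p c (- a) = - g p c a" if "a \<in> fib K p" "c \<in> fib K p" for a c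
  proof -
    have "g p (- a) c = - g p a c"
      using g_linear[OF that(2)] vs that(1)
      by (intro lin_on_uminus[where sc = "smul K" and sc' = "(*)" and S = "fib K p"])
        (auto intro!: vector_space.intro simp: algebra_simps)
    then show ?thesis using that sub by (simp add: g_symmetric[of c] subspace_neg)
  qed
  \<comment> \<open>Passing to the adjoint flips the sign of \<open>Q\<close> and keeps the identity
    and \<open>C p Y\<close>; the difference therefore leaves only twice \<open>Q\<close>.\<close>
  have "g_adjoint K g ?E p s = - Q p s + s + C p Y s"
  proof (rule g_adjoint_eqI[OF vs sub])
    show "- Q p s + s + C p Y s \<in> fib K p"
      using sub Q CY s by (intro subspace_add subspace_neg) auto
    fix a assume a: "a \<in> fib K p"
    show "g p (?E p a) s = g p a (- Q p s + s + C p Y s)"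
      using a s Q CY sub
      by (simp only: E plus uminus subspace_add subspace_neg Q_g_skew C_selfadjoint[OF Y(1)])
  qed (auto intro: g_symmetric g_linear g_nondegenerate)
  then have "?E p s - g_adjoint K g ?E p s = Q p s + Q p s"
    by (simp add: E s)
  then have "skew_part K g ?E p s = smul K (1/2) (Q p s + Q p s)"
    by (simp add: skew_part_def)
  \<comment> \<open>Scalars act through the abstract \<open>smul K\<close>, so halving the doubled
    vector goes through both distributive laws.\<close>
  also have "\<dots> = smul K (1/2 + 1/2) (Q p s)"
    by (simp only: scale_right_distrib scale_left_distrib)
  finally show ?thesis by simp
qed

end

theorem lemma3p9:
  fixes A :: "('m::{t2_space, second_countable_topology}, 'n::finite) chart set"
    and K :: "('m, 'e::ab_group_add, 'r::finite) vbundle"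
    and C :: "'m \<Rightarrow> ('m, 'n) tvec \<Rightarrow> 'e \<Rightarrow> 'e"
    and U \<kappa> Q :: "'m \<Rightarrow> 'e \<Rightarrow> 'e"
    and g h :: "'m \<Rightarrow> 'e \<Rightarrow> 'e \<Rightarrow> complex"
    and D :: "('m, 'n, 'e) conn"
    and \<zeta> :: "'m \<Rightarrow> 'e"
  assumes "cv_structure A K C U g \<kappa> h D Q"
    and "primitive_section A K C \<zeta>"
  shows "\<forall>p. \<forall>s \<in> fib K p. Q p s = skew_part K g (DU_endo A K D C U \<zeta>) p s"
  using cv_structure.Q_eq_skew_part[OF assms] by blast

end
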